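(* Let $B$ be a finite Boolean algebra. Then the map $\sigma\colon\mathrm{UC}(B)\to\mathrm{SC}(\mathrm{Atom}(B))$ given by $\sigma(\mathscr K)=\mathscr K\cap 2^{\mathrm{Atom}(B)}_+$ is well defined and is an order isomorphism with respect to set inclusion.
   Context: Let $B$ be a non-trivial Boolean algebra with order $\le$ and join $+$; $\mathrm{Atom}(B)$ is its set of atoms and $2^X_+$ denotes the set of non-empty subsets of a set $X$. For $F,G\subseteq B$ put $F+G=\{f+g: f\in F,\ g\in G\}$, and write $F\preceq G$ iff for every $g\in G$ there is $f\in F$ with $f\le g$. An ultracontact on $B$ is a family $\mathscr K\subseteq 2^B$ such that for all $F,G\subseteq B$: (K0) $\emptyset\notin\mathscr K$; (K1) if $0\in F$ then $F\notin\mathscr K$; (K2) if $x\neq 0$ then $\{x\}\in\mathscr K$; (K3) if $F\preceq G$, $G\neq\emptyset$ and $F\in\mathscr K$, then $G\in\mathscr K$; (K4) if $F+G\in\mathscr K$ then $F\in\mathscr K$ or $G\in\mathscr K$. $\mathrm{UC}(B)$ is the set of ultracontacts on $B$. For a set $V$, $\mathrm{SC}(V)$ is the set of all families $\Sigma$ of finite non-empty subsets of $V$ such that $\{v\}\in\Sigma$ for every $v\in V$ and, whenever $S\in\Sigma$ and $\emptyset\neq T\subseteq S$, $T\in\Sigma$ (i.e. abstract simplicial complexes on vertex set $V$). Both $\mathrm{UC}(B)$ and $\mathrm{SC}(V)$ are ordered by inclusion. *)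

theory Defs
  imports Main
begin

text \<open>The Boolean algebra \<open>B\<close> is the universe of a type of class \<open>boolean_algebra\<close>;
  the join \<open>+\<close> of the source is \<open>sup\<close> and its \<open>0\<close> is \<open>bot\<close>.\<close>

definition Atom :: "'a::boolean_algebra set" where
  "Atom = {a. a \<noteq> bot \<and> (\<forall>x. x \<le> a \<longrightarrow> x = bot \<or> x = a)}"

definition nonempty_subsets :: "'a set \<Rightarrow> 'a set set" where
  "nonempty_subsets X = {S. S \<subseteq> X \<and> S \<noteq> {}}"

definition set_join :: "'a::boolean_algebra set \<Rightarrow> 'a set \<Rightarrow> 'a set" where
  "set_join F G = {sup f g | f g. f \<in> F \<and> g \<in> G}"

definition refines :: "'a::boolean_algebra set \<Rightarrow> 'a set \<Rightarrow> bool" where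
  "refines F G \<longleftrightarrow> (\<forall>g\<in>G. \<exists>f\<in>F. f \<le> g)"

definition ultracontact :: "'a::boolean_algebra set set \<Rightarrow> bool" where
  "ultracontact K \<longleftrightarrow>
     {} \<notin> K \<and>
     (\<forall>F. bot \<in> F \<longrightarrow> F \<notin> K) \<and>
     (\<forall>x. x \<noteq> bot \<longrightarrow> {x} \<in> K) \<and>
     (\<forall>F G. refines F G \<and> G \<noteq> {} \<and> F \<in> K \<longrightarrow> G \<in> K) \<and>
     (\<forall>F G. set_join F G \<in> K \<longrightarrow> F \<in> K \<or> G \<in> K)"

definition UC :: "'a::boolean_algebra set set set" where
  "UC = {K. ultracontact K}"

definition SC :: "'v set \<Rightarrow> 'v set set set" where
  "SC V = {\<Sigma>. (\<forall>S\<in>\<Sigma>. finite S \<and> S \<noteq> {} \<and> S \<subseteq> V) \<and>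
               (\<forall>v\<in>V. {v} \<in> \<Sigma>) \<and>
               (\<forall>S\<in>\<Sigma>. \<forall>T. T \<noteq> {} \<and> T \<subseteq> S \<longrightarrow> T \<in> \<Sigma>)}"

definition atom_trace :: "'a::boolean_algebra set set \<Rightarrow> 'a set set" where
  "atom_trace K = K \<inter> nonempty_subsets Atom"

definition order_isomorphism ::
    "'a::order set \<Rightarrow> 'b::order set \<Rightarrow> ('a \<Rightarrow> 'b) \<Rightarrow> bool" where
  "order_isomorphism P Q h \<longleftrightarrow>
     bij_betw h P Q \<and> (\<forall>x\<in>P. \<forall>y\<in>P. x \<le> y \<longleftrightarrow> h x \<le> h y)"

end

theory Submission
  imports Defs
begin

text \<open>The inverse of the trace sends a complex \<open>\<Sigma>\<close> to the family of all non-empty \<open>F\<close> refined by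
  some \<open>S \<in> \<Sigma>\<close>; (K4) holds for it because atoms are join-prime. That the trace determines an
  ultracontact \<open>K\<close> follows by splitting: if \<open>x \<in> G \<in> K\<close> and \<open>x\<close> is not an atom, then
  \<open>x = y + z\<close> with \<open>y, z < x\<close>, and by (K4) replacing \<open>x\<close> in \<open>G\<close> by one of \<open>y\<close>, \<open>z\<close> gives
  another member of \<open>K\<close>, refining \<open>G\<close>. By finiteness this stops at a set of atoms in \<open>K\<close>.\<close>

lemma refines_refl: "refines F F"
  by (auto simp: refines_def)

lemma refines_trans: "refines F G \<Longrightarrow> refines G H \<Longrightarrow> refines F H"
  unfolding refines_def by (meson order_trans)

lemma refines_superset: "T \<subseteq> S \<Longrightarrow> refines S T"
  by (auto simp: refines_def)

lemma
  assumes "ultracontact K"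
  shows ultracontact_empty: "{} \<notin> K"
    and ultracontact_bot: "F \<in> K \<Longrightarrow> bot \<notin> F"
    and ultracontact_singleton: "x \<noteq> bot \<Longrightarrow> {x} \<in> K"
    and ultracontact_refines: "F \<in> K \<Longrightarrow> refines F G \<Longrightarrow> G \<noteq> {} \<Longrightarrow> G \<in> K"
    and ultracontact_join: "set_join F G \<in> K \<Longrightarrow> F \<in> K \<or> G \<in> K"
  using assms unfolding ultracontact_def by metis+

lemma atom_below:
  assumes "finite (UNIV :: 'a::boolean_algebra set)" and "(x::'a) \<noteq> bot"
  obtains a where "a \<in> Atom" "a \<le> x"
proof -
  have "finite {y::'a. y \<noteq> bot}"
    using assms(1) by (rule rev_finite_subset) simp
  then obtain a where "a \<noteq> bot" "a \<le> x" "\<And>b. b \<noteq> bot \<Longrightarrow> b \<le> a \<Longrightarrow> a = b"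
    using finite_has_minimal2[of "{y. y \<noteq> bot}" x] assms(2) by auto
  then show thesis
    by (intro that) (auto simp: Atom_def)
qed

lemma atom_le_atom: "a \<in> Atom \<Longrightarrow> b \<in> Atom \<Longrightarrow> a \<le> b \<Longrightarrow> a = b"
  by (auto simp: Atom_def)

text \<open>By distributivity: an atom not below \<open>z\<close> meets \<open>z\<close> in
  \<open>bot\<close>, so an atom below neither \<open>x\<close> nor \<open>y\<close> would meet
  \<open>sup x y\<close> in \<open>bot\<close>.\<close>

lemma atom_le_sup:
  assumes "a \<in> Atom" and "a \<le> sup x y"
  shows "a \<le> x \<or> a \<le> y"
proof (rule ccontr)
  assume *: "\<not> (a \<le> x \<or> a \<le> y)"
  have meet_bot: "inf a z = bot" if "\<not> a \<le> z" for z
    using assms(1) that unfolding Atom_def by (metis (mono_tags, lifting) inf.cobounded1 inf.orderI mem_Collect_eq)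
  have "a = inf a (sup x y)"
    using assms(2) by (simp add: inf_absorb1)
  also have "\<dots> = bot"
    using * meet_bot by (simp add: inf_sup_distrib1)
  finally show False
    using assms(1) by (simp add: Atom_def)
qed

lemma non_atom_split:
  fixes x :: "'a::boolean_algebra"
  assumes "x \<noteq> bot" and "x \<notin> Atom"
  obtains y z where "y < x" "z < x" "sup y z = x"
proof -
  obtain y where y: "y \<le> x" "y \<noteq> bot" "y \<noteq> x"
    using assms by (auto simp: Atom_def)
  \<comment> \<open>The complement of \<open>y\<close> relative to \<open>x\<close>. It differs from
    \<open>x\<close>, since otherwise \<open>y \<le> x \<le> - y\<close>, which forces
    \<open>y = bot\<close>.\<close>
  let ?z = "inf x (- y)"
  have "sup y ?z = x"
    using y(1) by (simp add: sup_inf_distrib1 sup_absorb2)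
  moreover have "?z \<noteq> x"
  proof
    assume "?z = x"
    then have "y \<le> - y"
      using y(1) by (metis inf.cobounded2 order_trans)
    then show False
      using y(2) by (metis inf.absorb1 inf_compl_bot)
  qed
  ultimately show thesis
    using y by (intro that[of y ?z]) (auto simp: less_le)
qed

lemma ultracontact_atom_refinement:
  assumes fin: "finite (UNIV :: 'a::boolean_algebra set)"
    and K: "ultracontact (K :: 'a set set)" and "F \<in> K"
  obtains S where "S \<in> K" "S \<subseteq> Atom" "refines S F"
proof -
  have fin_set: "finite A" for A :: "'a set"
    using fin by (rule rev_finite_subset) simp
  \<comment> \<open>Termination measure: going down strictly from \<open>x\<close> to
    \<open>t\<close> shrinks the down-set, so replacing \<open>x\<close> by \<open>t\<close> in
    \<open>F\<close> lowers the total.\<close>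
  define w where "w F = (\<Sum>x\<in>F. card {..x})" for F :: "'a set"
  have "\<exists>S\<in>K. S \<subseteq> Atom \<and> refines S F"
    using \<open>F \<in> K\<close>
  proof (induction "w F" arbitrary: F rule: less_induct)
    case less
    show ?case
    proof (cases "F \<subseteq> Atom")
      case True
      then show ?thesis
        using less.prems refines_refl by blast
    next
      case False
      then obtain x where x: "x \<in> F" "x \<notin> Atom"
        by blast
      moreover have "x \<noteq> bot"
        using ultracontact_bot[OF K less.prems] x(1) by blast
      ultimately obtain y z where yz: "y < x" "z < x" "sup y z = x"
        using non_atom_split by metis
      define H where "H t = insert t (F - {x})" for t
      have smaller: "w (H t) < w F" and refining: "refines (H t) F" if "t < x" for t
      proof -
        have "{..t} \<subset> {..x}"
          using that by (auto simp: less_le_not_le intro: order_trans)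
        then have "card {..t} < card {..x}"
          using fin_set by (simp add: psubset_card_mono)
        \<comment> \<open>Only an inequality, because \<open>t\<close> may already belong to
          \<open>F - {x}\<close>.\<close>
        moreover have "w (H t) \<le> card {..t} + w (F - {x})"
          by (simp add: w_def H_def sum.insert_if fin_set)
        moreover have "w F = card {..x} + w (F - {x})"
          unfolding w_def by (rule sum.remove[OF fin_set x(1)])
        ultimately show "w (H t) < w F"
          by linarith
        show "refines (H t) F"
          using that by (auto simp: refines_def H_def dest: less_imp_le)
      qed
      \<comment> \<open>A join of members of \<open>H y\<close> and \<open>H z\<close> is either
        \<open>sup y z = x\<close> or has a summand in \<open>F - {x}\<close>; in both cases it lies
        above a member of \<open>F\<close>. So (K3) puts \<open>set_join (H y) (H z)\<close> in
        \<open>K\<close>, and (K4) selects one of the two.\<close>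
      have "refines F (set_join (H y) (H z))"
        using x(1) yz(3) by (auto simp: refines_def set_join_def H_def intro: le_supI1 le_supI2)
      moreover have "set_join (H y) (H z) \<noteq> {}"
        by (auto simp: set_join_def H_def)
      ultimately have "H y \<in> K \<or> H z \<in> K"
        by (intro ultracontact_join[OF K] ultracontact_refines[OF K less.prems])
      then obtain t where t: "t < x" "H t \<in> K"
        using yz by blast
      obtain S where "S \<in> K" "S \<subseteq> Atom" "refines S (H t)"
        using less.hyps[OF smaller[OF t(1)] t(2)] by blast
      then show ?thesis
        using refines_trans[OF _ refining[OF t(1)]] by blast
    qed
  qed
  then show thesis
    using that by blast
qed

lemma atom_trace_in_SC:
  assumes fin: "finite (UNIV :: 'a::boolean_algebra set)" and K: "ultracontact (K :: 'a set set)"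
  shows "atom_trace K \<in> SC Atom"
proof -
  have "finite S" for S :: "'a set"
    using fin by (rule rev_finite_subset) simp
  moreover have "{v} \<in> K" if "v \<in> Atom" for v
    using ultracontact_singleton[OF K] that by (auto simp: Atom_def)
  moreover have "T \<in> K" if "S \<in> K" "T \<noteq> {}" "T \<subseteq> S" for S T
    using ultracontact_refines[OF K] refines_superset that by blast
  ultimately show ?thesis
    unfolding SC_def atom_trace_def nonempty_subsets_def
    by (intro CollectI conjI ballI allI impI IntI) (simp_all, blast+)
qed

text \<open>Each \<open>F\<close> in \<open>K\<close> is refined by a set of atoms in
  \<open>K\<close>. That set lies in the trace of \<open>K\<close>, hence in \<open>L\<close>, and
  (K3) for \<open>L\<close> leads back up to \<open>F\<close>. Reflecting inclusion also makes the
  trace injective.\<close>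

lemma atom_trace_le_iff:
  assumes fin: "finite (UNIV :: 'a::boolean_algebra set)"
    and K: "ultracontact (K :: 'a set set)" and L: "ultracontact L"
  shows "atom_trace K \<subseteq> atom_trace L \<longleftrightarrow> K \<subseteq> L"
proof
  assume le: "atom_trace K \<subseteq> atom_trace L"
  show "K \<subseteq> L"
  proof
    fix F assume "F \<in> K"
    then obtain S where S: "S \<in> K" "S \<subseteq> Atom" "refines S F"
      using ultracontact_atom_refinement[OF fin K] by metis
    have "F \<noteq> {}" "S \<noteq> {}"
      using ultracontact_empty[OF K] \<open>F \<in> K\<close> S(1) by auto
    then have "S \<in> L"
      using le S by (auto simp: atom_trace_def nonempty_subsets_def)
    then show "F \<in> L"
      using ultracontact_refines[OF L] S(3) \<open>F \<noteq> {}\<close> by blast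
  qed
qed (auto simp: atom_trace_def)

text \<open>\<open>refines S {}\<close> holds vacuously, so (K0) depends on the clause
  \<open>F \<noteq> {}\<close>.\<close>

definition refined_by :: "'a::boolean_algebra set set \<Rightarrow> 'a set set" where
  "refined_by \<Sigma> = {F. F \<noteq> {} \<and> (\<exists>S\<in>\<Sigma>. refines S F)}"

lemma ultracontact_refined_by:
  assumes fin: "finite (UNIV :: 'a::boolean_algebra set)"
    and \<Sigma>: "\<Sigma> \<in> SC (Atom :: 'a set)"
  shows "ultracontact (refined_by \<Sigma>)"
  unfolding ultracontact_def
proof (intro conjI allI impI)
  have atoms: "a \<in> Atom" if "S \<in> \<Sigma>" "a \<in> S" for S a
    using \<Sigma> that by (auto simp: SC_def)
  show "{} \<notin> refined_by \<Sigma>"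
    by (simp add: refined_by_def)
  show "F \<notin> refined_by \<Sigma>" if "bot \<in> F" for F
    using that atoms by (fastforce simp: refined_by_def refines_def Atom_def le_bot)
  show "{x} \<in> refined_by \<Sigma>" if "x \<noteq> bot" for x
  proof -
    obtain a where "a \<in> Atom" "a \<le> x"
      using atom_below[OF fin \<open>x \<noteq> bot\<close>] .
    then have "{a} \<in> \<Sigma>" "refines {a} {x}"
      using \<Sigma> by (auto simp: SC_def refines_def)
    then show ?thesis
      by (auto simp: refined_by_def)
  qed
  show "G \<in> refined_by \<Sigma>" if "refines F G \<and> G \<noteq> {} \<and> F \<in> refined_by \<Sigma>" for F G
    using that refines_trans by (auto simp: refined_by_def)
  show "F \<in> refined_by \<Sigma> \<or> G \<in> refined_by \<Sigma>" if join: "set_join F G \<in> refined_by \<Sigma>" for F G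
  proof -
    obtain S where S: "S \<in> \<Sigma>" "refines S (set_join F G)" and "set_join F G \<noteq> {}"
      using join by (auto simp: refined_by_def)
    then have ne: "F \<noteq> {}" "G \<noteq> {}"
      by (auto simp: set_join_def)
    have "refines S F \<or> refines S G"
    proof (rule ccontr)
      \<comment> \<open>Each failed refinement supplies one element with no member of
        \<open>S\<close> below it. The join of these two does have some \<open>s\<close> in
        \<open>S\<close> below it, against join-primeness of the atom \<open>s\<close>.\<close>
      assume "\<not> ?thesis"
      then obtain f g where fg: "f \<in> F" "g \<in> G" "\<And>s. s \<in> S \<Longrightarrow> \<not> s \<le> f \<and> \<not> s \<le> g"
        unfolding refines_def by blast
      then have "sup f g \<in> set_join F G"
        by (auto simp: set_join_def)
      then obtain s where "s \<in> S" "s \<le> sup f g"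
        using S(2) by (auto simp: refines_def)
      then show False
        using atom_le_sup atoms S(1) fg(3) by blast
    qed
    then show ?thesis
      using S(1) ne by (auto simp: refined_by_def)
  qed
qed

text \<open>Distinct atoms are incomparable, so between sets of atoms \<open>refines S T\<close>
  amounts to \<open>T \<subseteq> S\<close>. The trace therefore consists of the non-empty subsets
  of members of \<open>\<Sigma>\<close>, and a complex already contains these.\<close>

lemma atom_trace_refined_by:
  assumes "\<Sigma> \<in> SC (Atom :: 'a::boolean_algebra set)"
  shows "atom_trace (refined_by \<Sigma>) = \<Sigma>"
proof
  show "\<Sigma> \<subseteq> atom_trace (refined_by \<Sigma>)"
    using assms refines_refl by (auto simp: SC_def atom_trace_def nonempty_subsets_def refined_by_def)
  show "atom_trace (refined_by \<Sigma>) \<subseteq> \<Sigma>"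
  proof
    fix T assume "T \<in> atom_trace (refined_by \<Sigma>)"
    then obtain S where S: "S \<in> \<Sigma>" "refines S T" and T: "T \<subseteq> Atom" "T \<noteq> {}"
      by (auto simp: atom_trace_def nonempty_subsets_def refined_by_def)
    have "S \<subseteq> Atom"
      using assms S(1) by (auto simp: SC_def)
    have "T \<subseteq> S"
    proof
      fix t assume "t \<in> T"
      then obtain s where "s \<in> S" "s \<le> t"
        using S(2) by (auto simp: refines_def)
      then show "t \<in> S"
        using atom_le_atom \<open>S \<subseteq> Atom\<close> T(1) \<open>t \<in> T\<close> by blast
    qed
    then show "T \<in> \<Sigma>"
      using assms S(1) T(2) unfolding SC_def by blast
  qed
qed

theorem theorem7p4:
  assumes finite_B: "finite (UNIV :: 'a::boolean_algebra set)"
    and nontrivial_B: "(bot :: 'a) \<noteq> top"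
  shows "(\<forall>K \<in> (UC :: 'a set set set). atom_trace K \<in> SC (Atom :: 'a set)) \<and>
    order_isomorphism (UC :: 'a set set set) (SC (Atom :: 'a set)) atom_trace"
proof -
  have well_defined: "atom_trace K \<in> SC Atom" if "K \<in> UC" for K :: "'a set set"
    using atom_trace_in_SC[OF finite_B] that by (simp add: UC_def)
  have le_iff: "atom_trace K \<subseteq> atom_trace L \<longleftrightarrow> K \<subseteq> L" if "K \<in> UC" "L \<in> UC" for K L :: "'a set set"
    using atom_trace_le_iff[OF finite_B] that by (simp add: UC_def)
  have "inj_on atom_trace (UC :: 'a set set set)"
  proof (rule inj_onI)
    fix K L :: "'a set set"
    assume "K \<in> UC" "L \<in> UC" "atom_trace K = atom_trace L"
    then show "K = L"
      using le_iff[of K L] le_iff[of L K] by simp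
  qed
  \<comment> \<open>Surjectivity: \<open>refined_by \<Sigma>\<close> is the preimage.\<close>
  moreover have "\<Sigma> \<in> atom_trace ` UC" if "\<Sigma> \<in> SC (Atom :: 'a set)" for \<Sigma>
    using ultracontact_refined_by[OF finite_B that] atom_trace_refined_by[OF that]
    by (metis UC_def image_eqI mem_Collect_eq)
  ultimately have "bij_betw atom_trace (UC :: 'a set set set) (SC Atom)"
    using well_defined by (auto simp: bij_betw_def)
  then show ?thesis
    using well_defined le_iff by (simp add: order_isomorphism_def)
qed

end
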